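(* Let $a,b\in\mathbb{C}$ with $|a|^2+|b|^2=1$, let $|\eta\rangle=a|00\rangle+b|11\rangle$ and let $|\xi\rangle=a|0\rangle^{\otimes j}+b|1\rangle^{\otimes j}$ be a $j$-qubit state. Then the output of $x$ successive entanglement swaps in a linear network containing the one multipartite state $|\xi\rangle$ and $x$ copies of $|\eta\rangle$ is $$S^{\otimes x}\left(|\eta\rangle^{\otimes x}\otimes|\xi\rangle\right)=|\xi_{x+1-2n}\rangle\ \text{ with probability }\ \binom{x+1}{n}|a|^{2n}|b|^{2n}\,n^2_{x+1-2n},\qquad 0\le n\le\frac{x+1}{2}.$$
   Context: For a nonnegative integer $m$ put $n_m=\sqrt{|a|^{2m}+|b|^{2m}}$ (so $n_1=1$), $|\eta_m\rangle=\frac{a^m|00\rangle+b^m|11\rangle}{n_m}$ and $|\xi_m\rangle=\frac{a^m|0\rangle^{\otimes j}+b^m|1\rangle^{\otimes j}}{n_m}$, so that $|\eta_1\rangle=|\eta\rangle$ and $|\xi_1\rangle=|\xi\rangle$. (The symbol $n_m$ with a subscript is this normalization factor; $n$ without subscript is an integer index.) The entanglement swap map $S$ between the $j$-qubit state $|\xi_m\rangle$ (qubits $1,\dots,j$) and the two-qubit state $|\eta_p\rangle$ (qubits $j+1,j+2$), with $m\ge p$, is: apply CNOT with control qubit $j$ and target qubit $j+1$; apply a Hadamard gate to qubit $j$; measure qubits $j$ and $j+1$ in the computational basis; apply $Z$ to qubit $j-1$ if the outcome on qubit $j$ is $1$, and apply $X$ to qubit $j+2$ if the outcome on qubit $j+1$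 is $1$. The output is the resulting $j$-qubit state of the unmeasured qubits; it is either $|\xi_{m+p}\rangle$ or $|\xi_{m-p}\rangle$. Global phases are disregarded. The measurement outcomes are not used, so the output is described by listing the possible states together with their probabilities. $S^{\otimes x}(|\eta\rangle^{\otimes x}\otimes|\xi\rangle)$ denotes the result of $x$ sequential swaps, starting from $|\xi\rangle$ and swapping the current $j$-qubit state with a fresh copy of $|\eta\rangle$ each time.
   Formalization: For 2n=x+1 the probability proved is half the printed one (printed value fails at x=1, n=1, ab≠0, since n_0²=2); the swap of ξ_0 with η_1, undefined in the paper (m<p), applies the X correction to qubits 1..j-1 instead of j+2, giving ξ_1; j≥2. *)

theory Defs
  imports Complex_Main
begin

text \<open>
  A pure state of \<open>k\<close> qubits is given by its amplitudes in the computational basis, whose vectors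
  are the bit words of length \<open>k\<close>.  Qubits are numbered from 1: qubit \<open>i\<close> is entry \<open>i - 1\<close>
  of the word.  All states below have amplitude 0 at words of any other length.
\<close>

type_synonym state = "bool list \<Rightarrow> complex"

definition qubit :: "bool list \<Rightarrow> nat \<Rightarrow> bool" where
  "qubit w i = w ! (i - 1)"

definition set_qubit :: "bool list \<Rightarrow> nat \<Rightarrow> bool \<Rightarrow> bool list" where
  "set_qubit w i c = w[i - 1 := c]"

definition ket :: "bool list \<Rightarrow> state" where
  "ket v = (\<lambda>w. of_bool (w = v))"

definition norm_sq :: "nat \<Rightarrow> state \<Rightarrow> real" where
  "norm_sq k \<psi> = (\<Sum>w | length w = k. (cmod (\<psi> w))\<^sup>2)"

definition tensor :: "nat \<Rightarrow> state \<Rightarrow> state \<Rightarrow> state" where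
  "tensor k \<psi> \<phi> = (\<lambda>w. \<psi> (take k w) * \<phi> (drop k w))"

definition same_up_to_phase :: "state \<Rightarrow> state \<Rightarrow> bool" where
  "same_up_to_phase \<psi> \<phi> \<longleftrightarrow> (\<exists>c. cmod c = 1 \<and> \<psi> = (\<lambda>w. c * \<phi> w))"

text \<open>A one-qubit gate is a matrix with rows and columns indexed by \<open>bool\<close>.\<close>

definition gate1 :: "(bool \<Rightarrow> bool \<Rightarrow> complex) \<Rightarrow> nat \<Rightarrow> state \<Rightarrow> state" where
  "gate1 U i \<psi> = (\<lambda>w. \<Sum>c\<in>UNIV. U (qubit w i) c * \<psi> (set_qubit w i c))"

definition pauli_X :: "bool \<Rightarrow> bool \<Rightarrow> complex" where
  "pauli_X r c = (if r = c then 0 else 1)"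

definition pauli_Z :: "bool \<Rightarrow> bool \<Rightarrow> complex" where
  "pauli_Z r c = (if r = c then (if r then -1 else 1) else 0)"

definition hadamard :: "bool \<Rightarrow> bool \<Rightarrow> complex" where
  "hadamard r c = (if r \<and> c then -1 else 1) / complex_of_real (sqrt 2)"

definition cnot :: "nat \<Rightarrow> nat \<Rightarrow> state \<Rightarrow> state" where
  "cnot i t \<psi> = (\<lambda>w. \<psi> (set_qubit w t (qubit w t \<noteq> qubit w i)))"

definition n_fac :: "complex \<Rightarrow> complex \<Rightarrow> nat \<Rightarrow> real" where
  "n_fac a b m = sqrt (cmod a ^ (2 * m) + cmod b ^ (2 * m))"

definition xi :: "complex \<Rightarrow> complex \<Rightarrow> nat \<Rightarrow> nat \<Rightarrow> state" where
  "xi a b j m = (\<lambda>w. (a ^ m * ket (replicate j False) w + b ^ m * ket (replicate j True) w)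
                      / complex_of_real (n_fac a b m))"

text \<open>
  The swap between a \<open>j\<close>-qubit state \<open>\<psi>\<close> (standing for \<open>\<xi>\<^sub>m\<close>, qubits \<open>1..j\<close>) and a two-qubit
  state \<open>\<phi>\<close> (standing for \<open>\<eta>\<^sub>p\<close>, qubits \<open>j+1, j+2\<close>); \<open>r\<close> and \<open>s\<close> are the outcomes on the
  qubits \<open>j\<close> and \<open>j+1\<close>.
\<close>

definition before_measurement :: "nat \<Rightarrow> state \<Rightarrow> state \<Rightarrow> state" where
  "before_measurement j \<psi> \<phi> = gate1 hadamard j (cnot j (j + 1) (tensor j \<psi> \<phi>))"

definition project :: "nat \<Rightarrow> bool \<Rightarrow> bool \<Rightarrow> state \<Rightarrow> state" where
  "project j r s \<Psi> = (\<lambda>w. if qubit w j = r \<and> qubit w (j + 1) = s then \<Psi> w else 0)"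

definition outcome_prob :: "nat \<Rightarrow> state \<Rightarrow> state \<Rightarrow> bool \<Rightarrow> bool \<Rightarrow> real" where
  "outcome_prob j \<psi> \<phi> r s = norm_sq (j + 2) (project j r s (before_measurement j \<psi> \<phi>))"

definition after_measurement :: "nat \<Rightarrow> state \<Rightarrow> state \<Rightarrow> bool \<Rightarrow> bool \<Rightarrow> state" where
  "after_measurement j \<psi> \<phi> r s =
     (\<lambda>w. project j r s (before_measurement j \<psi> \<phi>) w
           / complex_of_real (sqrt (outcome_prob j \<psi> \<phi> r s)))"

text \<open>
  For \<open>m \<ge> p\<close> the bit-flip correction acts on qubit \<open>j + 2\<close>.  The case \<open>m < p\<close> arises when
  \<open>\<xi>\<^sub>0\<close> is swapped with \<open>\<eta>\<^sub>1\<close>.  There the roles of the two states are exchanged: the correction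
  acts on the remaining qubits \<open>1..j-1\<close> of the first state, so that the output is \<open>\<xi>\<^bsub>p-m\<^esub>\<close>.
  (Correcting qubit \<open>j + 2\<close> would give \<open>\<xi>\<^bsub>p-m\<^esub>\<close> with all qubits flipped, which is not among
  the states \<open>\<xi>\<^sub>k\<close>.)
\<close>

definition correct_X :: "nat \<Rightarrow> nat \<Rightarrow> nat \<Rightarrow> state \<Rightarrow> state" where
  "correct_X j m p \<Psi> =
     (if p \<le> m then gate1 pauli_X (j + 2) \<Psi> else fold (gate1 pauli_X) [1..<j] \<Psi>)"

definition corrected :: "nat \<Rightarrow> nat \<Rightarrow> nat \<Rightarrow> state \<Rightarrow> state \<Rightarrow> bool \<Rightarrow> bool \<Rightarrow> state" where
  "corrected j m p \<psi> \<phi> r s =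
     (if s then correct_X j m p else id)
       ((if r then gate1 pauli_Z (j - 1) else id) (after_measurement j \<psi> \<phi> r s))"

text \<open>The qubits \<open>j\<close> and \<open>j + 1\<close>, now in the state \<open>r\<close>, \<open>s\<close>, are dropped.\<close>

definition swap_result :: "nat \<Rightarrow> nat \<Rightarrow> nat \<Rightarrow> state \<Rightarrow> state \<Rightarrow> bool \<Rightarrow> bool \<Rightarrow> state" where
  "swap_result j m p \<psi> \<phi> r s =
     (\<lambda>w. corrected j m p \<psi> \<phi> r s (take (j - 1) w @ [r, s] @ drop (j - 1) w))"

text \<open>
  The possible outputs, one for each pair of measurement outcomes, as triples of probability,
  index and state.  The index serves only to choose the correction in the next swap.
\<close>

definition swap_map :: "nat \<Rightarrow> nat \<Rightarrow> nat \<Rightarrow> state \<Rightarrow> state \<Rightarrow> (real \<times> nat \<times> state) list" where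
  "swap_map j m p \<psi> \<phi> =
     map (\<lambda>(r, s). (outcome_prob j \<psi> \<phi> r s,
                     if \<not> s then m + p else if p \<le> m then m - p else p - m,
                     swap_result j m p \<psi> \<phi> r s))
         [(False, False), (False, True), (True, False), (True, True)]"

text \<open>Successive swaps of \<open>\<xi> = \<xi>\<^sub>1\<close> with fresh copies of \<open>\<eta> = \<eta>\<^sub>1\<close>; probabilities multiply.\<close>

fun swaps :: "nat \<Rightarrow> state \<Rightarrow> state \<Rightarrow> nat \<Rightarrow> (real \<times> nat \<times> state) list" where
  "swaps j \<eta> \<xi> 0 = [(1, 1, \<xi>)]"
| "swaps j \<eta> \<xi> (Suc x) =
     concat (map (\<lambda>(q, m, \<psi>). map (\<lambda>(q', m', \<psi>'). (q * q', m', \<psi>')) (swap_map j m 1 \<psi> \<eta>))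
                 (swaps j \<eta> \<xi> x))"

definition swap_output :: "nat \<Rightarrow> state \<Rightarrow> state \<Rightarrow> nat \<Rightarrow> (real \<times> state) list" where
  "swap_output j \<eta> \<xi> x = map (\<lambda>(q, m, \<psi>). (q, \<psi>)) (swaps j \<eta> \<xi> x)"

text \<open>
  An ensemble is listed as ``\<open>\<phi> n\<close> with probability \<open>P n\<close>, for \<open>n \<in> I\<close>'' if its branches can be
  grouped by \<open>I\<close> so that those that occur in group \<open>n\<close> have state \<open>\<phi> n\<close> (up to a phase) and
  group \<open>n\<close> has total probability \<open>P n\<close>.  Grouping, rather than summing over all branches with
  state \<open>\<phi> n\<close>, is needed because different \<open>n\<close> may have the same state (e.g. for \<open>a = b\<close>).
\<close>

definition listed_as ::
  "(real \<times> state) list \<Rightarrow> nat set \<Rightarrow> (nat \<Rightarrow> state) \<Rightarrow> (nat \<Rightarrow> real) \<Rightarrow> bool" where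
  "listed_as E I \<phi> P \<longleftrightarrow>
     (\<exists>g. (\<forall>i<length E. g i \<in> I \<and>
              (fst (E ! i) \<noteq> 0 \<longrightarrow> same_up_to_phase (snd (E ! i)) (\<phi> (g i)))) \<and>
          (\<forall>n\<in>I. (\<Sum>i | i < length E \<and> g i = n. fst (E ! i)) = P n))"

text \<open>
  With \<open>P n = ((x+1) choose n) |a|\<^sup>2\<^sup>n |b|\<^sup>2\<^sup>n (n_fac a b (x+1-2n))\<^sup>2\<close>, the terms \<open>n\<close> and \<open>x+1-n\<close> of the
  binomial expansion of \<open>(|a|\<^sup>2 + |b|\<^sup>2)\<^bsup>x+1\<^esup>\<close> add up to \<open>P n\<close> when \<open>2n < x+1\<close>.  For
  \<open>2n = x+1\<close> they are one and the same term, whereas \<open>(n_fac a b 0)\<^sup>2 = 2\<close>, so the probability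
  of that outcome is \<open>P n / 2\<close>.  For example, one swap yields \<open>\<xi>\<^sub>0\<close> with probability
  \<open>1 - |a|\<^sup>4 - |b|\<^sup>4 = 2|a|\<^sup>2|b|\<^sup>2\<close>, while \<open>P 1 = 4|a|\<^sup>2|b|\<^sup>2\<close>.
\<close>

end

theory Submission imports Defs begin

text \<open>
  Every state met in a swap is, after the measurement, a superposition of two basis words.  The
  index of the current state \<open>\<xi>\<^sub>k\<close> therefore performs a walk on the naturals: it moves to \<open>k + 1\<close>
  with probability \<open>n\<^sup>2\<^bsub>k+1\<^esub> / n\<^sup>2\<^bsub>k\<^esub>\<close>, to \<open>k - 1\<close> with probability \<open>|ab|\<^sup>2 n\<^sup>2\<^bsub>k-1\<^esub> / n\<^sup>2\<^bsub>k\<^esub>\<close> if \<open>k > 0\<close>, and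
  always to \<open>1\<close> if \<open>k = 0\<close>.  The factors \<open>n\<^sup>2\<^bsub>k\<^esub>\<close> telescope, so what remains is Pascal's rule; at
  \<open>k = 0\<close>, where \<open>n\<^sup>2\<^bsub>0\<^esub> = 2\<close>, it becomes \<open>(2n choose n) = 2 (2n-1 choose n-1)\<close>.
\<close>

section \<open>Two-term superpositions and the gates acting on them\<close>

definition superpos :: "complex \<Rightarrow> bool list \<Rightarrow> complex \<Rightarrow> bool list \<Rightarrow> state" where
  "superpos \<alpha> v \<beta> v' = (\<lambda>w. \<alpha> * ket v w + \<beta> * ket v' w)"

definition flip_qubit :: "nat \<Rightarrow> bool list \<Rightarrow> bool list" where
  "flip_qubit i w = set_qubit w i (\<not> qubit w i)"

lemma superpos_commute: "superpos \<alpha> v \<beta> v' = superpos \<beta> v' \<alpha> v"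
  by (auto simp: superpos_def)

text \<open>Only two words carry amplitude, and as they differ the coefficients do not
  interfere.\<close>

lemma norm_sq_superpos:
  assumes "length v = k" "length v' = k" "v \<noteq> v'"
  shows "norm_sq k (superpos \<alpha> v \<beta> v') = (cmod \<alpha>)\<^sup>2 + (cmod \<beta>)\<^sup>2"
proof -
  have fin: "finite {w :: bool list. length w = k}"
    using finite_lists_length_eq[of "UNIV :: bool set" k] by simp
  have "norm_sq k (superpos \<alpha> v \<beta> v') =
      (\<Sum>w \<in> {v, v'}. (cmod (superpos \<alpha> v \<beta> v' w))\<^sup>2)"
    unfolding norm_sq_def
    by (rule sum.mono_neutral_right) (use assms fin in \<open>auto simp: superpos_def ket_def\<close>)
  also have "\<dots> = (cmod \<alpha>)\<^sup>2 + (cmod \<beta>)\<^sup>2"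
    using assms by (auto simp: superpos_def ket_def)
  finally show ?thesis .
qed

lemma gate1_pauli_Z: "gate1 pauli_Z i \<psi> w = (if qubit w i then -1 else 1) * \<psi> w"
proof -
  have "set_qubit w i (qubit w i) = w" by (simp add: set_qubit_def qubit_def)
  then show ?thesis by (cases "qubit w i") (simp_all add: gate1_def pauli_Z_def UNIV_bool)
qed

lemma gate1_pauli_Z_superpos:
  "gate1 pauli_Z i (superpos \<alpha> v \<beta> v') =
     superpos ((if qubit v i then -1 else 1) * \<alpha>) v ((if qubit v' i then -1 else 1) * \<beta>) v'"
proof
  fix w
  show "gate1 pauli_Z i (superpos \<alpha> v \<beta> v') w = superpos ((if qubit v i then -1 else 1) * \<alpha>) v
     ((if qubit v' i then -1 else 1) * \<beta>) v' w"
    by (cases "w = v"; cases "w = v'") (simp_all add: gate1_pauli_Z superpos_def ket_def)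
qed

text \<open>An update past the end of a word changes nothing, so positions outside the word cause no
  exception.\<close>

lemma flip_qubit_flip_qubit [simp]: "flip_qubit i (flip_qubit i w) = w"
  by (cases "i - 1 < length w")
    (simp_all add: flip_qubit_def set_qubit_def qubit_def list_update_beyond)

lemma gate1_pauli_X: "gate1 pauli_X i \<psi> w = \<psi> (flip_qubit i w)"
  by (simp add: gate1_def pauli_X_def UNIV_bool flip_qubit_def)

text \<open>An involution can pass from the argument of a ket to its label; this is how X acts on
  basis words.\<close>

lemma ket_flip_qubit: "ket v (flip_qubit i w) = ket (flip_qubit i v) w"
proof -
  have "flip_qubit i w = v \<longleftrightarrow> w = flip_qubit i v" by auto
  then show ?thesis by (simp add: ket_def)
qed

lemma gate1_pauli_X_superpos:
  "gate1 pauli_X i (superpos \<alpha> v \<beta> v') = superpos \<alpha> (flip_qubit i v) \<beta> (flip_qubit i v')"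
  by (rule ext) (simp add: gate1_pauli_X superpos_def ket_flip_qubit)

lemma fold_pauli_X_superpos:
  "fold (gate1 pauli_X) is (superpos \<alpha> v \<beta> v') =
     superpos \<alpha> (fold flip_qubit is v) \<beta> (fold flip_qubit is v')"
  by (induction "is" arbitrary: v v') (simp_all add: gate1_pauli_X_superpos)

lemma flip_qubit_append:
  "flip_qubit (Suc (length u)) (u @ c # w) = u @ (\<not> c) # w"
  by (simp add: flip_qubit_def set_qubit_def qubit_def)

text \<open>\<open>w\<close> is generalised because the induction step counts the last qubit of the
  block as part of \<open>w\<close>. With \<open>j = Suc k\<close> these are the flips in
  \<open>correct_X\<close> for \<open>m < p\<close>.\<close>

lemma fold_flip_qubit_replicate:
  "fold flip_qubit [1..<Suc k] (replicate k c @ w) = replicate k (\<not> c) @ w"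
proof (induction k arbitrary: w)
  case (Suc k)
  have "fold flip_qubit [1..<Suc (Suc k)] (replicate (Suc k) c @ w)
      = flip_qubit (Suc k) (fold flip_qubit [1..<Suc k] (replicate k c @ c # w))"
    by (simp add: replicate_app_Cons_same)
  also have "\<dots> = flip_qubit (Suc k) (replicate k (\<not> c) @ c # w)"
    by (simp only: Suc.IH)
  also have "\<dots> = replicate k (\<not> c) @ (\<not> c) # w"
    using flip_qubit_append[of "replicate k (\<not> c)"] by simp
  finally show ?case by (simp add: replicate_app_Cons_same)
qed simp

section \<open>One swap of general two-term states\<close>

text \<open>After the CNOT, \<open>s\<close> is the parity of qubit \<open>j = Suc k\<close> and the
  first qubit of \<open>\<phi>\<close>. Hence \<open>s = False\<close> pairs \<open>\<alpha>\<close>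
  with \<open>\<gamma>\<close> and \<open>\<beta>\<close> with \<open>\<delta>\<close>, while
  \<open>s = True\<close> crosses the pairs. The Hadamard gate spreads each branch over both values
  of \<open>r\<close>, with sign -1 only where \<open>r\<close> and the old bit are both 1.\<close>

lemma project_before_measurement:
  fixes k :: nat and \<alpha> \<beta> \<gamma> \<delta> :: complex
  defines "\<psi> \<equiv> superpos \<alpha> (replicate (Suc k) False) \<beta> (replicate (Suc k) True)"
    and "\<phi> \<equiv> superpos \<gamma> [False, False] \<delta> [True, True]"
  shows "project (Suc k) r s (before_measurement (Suc k) \<psi> \<phi>) =
     superpos (\<alpha> * (if s then \<delta> else \<gamma>) / complex_of_real (sqrt 2)) (replicate k False @ [r, s, s])
       ((if r then -1 else 1) * \<beta> * (if s then \<gamma> else \<delta>) / complex_of_real (sqrt 2))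
       (replicate k True @ [r, s, \<not> s])" (is "?L = ?R")
proof
  fix w
  show "?L w = ?R w"
  proof (cases "length w = k + 3")
    case True
    define u where "u = take k w"
    from True have lu: "length u = k" by (simp add: u_def)
    have "length (drop k w) = Suc (Suc (Suc 0))" using True by simp
    then obtain r' s' t where "drop k w = [r', s', t]"
      by (auto simp: length_Suc_conv simp del: length_drop)
    then have w: "w = u @ [r', s', t]" unfolding u_def by (metis append_take_drop_id)
    have rep: "u @ [c] = replicate (Suc k) d \<longleftrightarrow> u = replicate k d \<and> c = d" for c d
      by (simp add: replicate_append_same[symmetric])
    have q: "qubit w (Suc k) = r'" "qubit w (Suc k + 1) = s'"
      by (simp_all add: w qubit_def lu nth_append)
    \<comment> \<open>Amplitudes are read backwards: \<open>c\<close> is qubit \<open>j\<close>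
      before the Hadamard gate, and undoing the CNOT turns \<open>s'\<close> into
      \<open>s' \<noteq> c\<close>.\<close>
    have "before_measurement (Suc k) \<psi> \<phi> w =
        (\<Sum>c\<in>UNIV. hadamard r' c * (\<psi> (u @ [c]) * \<phi> [s' \<noteq> c, t]))"
      by (simp add: before_measurement_def gate1_def cnot_def tensor_def set_qubit_def qubit_def
          w lu nth_append list_update_append)
    also have "\<dots> = hadamard r' False * (\<psi> (u @ [False]) * \<phi> [s', t])
        + hadamard r' True * (\<psi> (u @ [True]) * \<phi> [\<not> s', t])"
      by (simp add: UNIV_bool)
    finally have "before_measurement (Suc k) \<psi> \<phi> w = \<dots>" .
    moreover have "\<psi> (u @ [False]) = \<alpha> * of_bool (u = replicate k False)"
      "\<psi> (u @ [True]) = \<beta> * of_bool (u = replicate k True)"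
      by (simp_all add: \<psi>_def superpos_def ket_def rep del: replicate_Suc)
    moreover have "\<phi> [c, d] = (if c = d then if c then \<delta> else \<gamma> else 0)" for c d
      by (simp add: \<phi>_def superpos_def ket_def)
    moreover have "?R w = (if r' = r \<and> s' = s then
        (\<alpha> * (if s then \<delta> else \<gamma>) * of_bool (u = replicate k False \<and> t = s)
         + (if r then -1 else 1) * \<beta> * (if s then \<gamma> else \<delta>) * of_bool (u = replicate k True \<and> t \<noteq> s))
        / complex_of_real (sqrt 2) else 0)"
      by (simp add: superpos_def ket_def w lu add_divide_distrib)
    \<comment> \<open>For \<open>k = 0\<close> both equalities on \<open>u\<close> hold, so they are
      split independently.\<close>
    ultimately show ?thesis
      unfolding project_def q
      by (cases "u = replicate k False"; cases "u = replicate k True"; cases t; cases s; cases r)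
        (simp_all add: hadamard_def add_divide_distrib)
  next
    case False
    \<comment> \<open>\<open>project\<close> does not check lengths. The amplitude vanishes because
      the kets fix the lengths of both tensor factors and the gates preserve length.\<close>
    have "tensor (Suc k) \<psi> \<phi> w' = 0" if "length w' = length w" for w'
    proof (rule ccontr)
      assume "\<not> ?thesis"
      then have "length (take (Suc k) w') = Suc k" "length (drop (Suc k) w') = 2"
        by (auto simp: tensor_def \<psi>_def \<phi>_def superpos_def ket_def of_bool_def
            simp del: length_take length_drop split: if_splits)
      with that False show False by auto
    qed
    then have "before_measurement (Suc k) \<psi> \<phi> w = 0"
      by (simp add: before_measurement_def gate1_def cnot_def set_qubit_def)
    moreover have "?R w = 0" using False by (auto simp: superpos_def ket_def)
    ultimately show ?thesis by (simp add: project_def)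
  qed
qed

lemma superpos_drop_measured:
  assumes "length u = k" "length u' = k"
  shows "(\<lambda>w. superpos \<alpha> (u @ [r, s, t]) \<beta> (u' @ [r, s, t']) (take k w @ [r, s] @ drop k w))
       = superpos \<alpha> (u @ [t]) \<beta> (u' @ [t'])"
proof -
  have "take k w @ [r, s] @ drop k w = v @ [r, s, c] \<longleftrightarrow> w = v @ [c]" if "length v = k" for v w c
  proof
    assume eq: "take k w @ [r, s] @ drop k w = v @ [r, s, c]"
    then have "length (take k w @ [r, s] @ drop k w) = length (v @ [r, s, c])" by (rule arg_cong)
    \<comment> \<open>Equal total lengths force \<open>w\<close> to have length
      \<open>k + 1\<close>, so both words split at position \<open>k\<close>.\<close>
    then have "length (take k w) = length v" using that by (simp split: if_splits)
    with eq have "take k w = v" "drop k w = [c]" by auto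
    then show "w = v @ [c]" by (metis append_take_drop_id)
  qed (use that in auto)
  then show ?thesis using assms by (simp add: superpos_def ket_def)
qed

lemma n_fac_squared: "(n_fac a b m)\<^sup>2 = cmod a ^ (2 * m) + cmod b ^ (2 * m)"
  by (simp add: n_fac_def)

lemma n_fac_pos:
  assumes "(cmod a)\<^sup>2 + (cmod b)\<^sup>2 = 1"
  shows "n_fac a b m > 0"
proof -
  have "a \<noteq> 0 \<or> b \<noteq> 0" using assms by auto
  then have "cmod a ^ (2 * m) + cmod b ^ (2 * m) > 0"
    by (auto intro: add_pos_nonneg add_nonneg_pos)
  then show ?thesis by (simp add: n_fac_def)
qed

lemma xi_eq_superpos:
  "xi a b j m = superpos (a ^ m / complex_of_real (n_fac a b m)) (replicate j False)
     (b ^ m / complex_of_real (n_fac a b m)) (replicate j True)"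
  by (rule ext) (simp add: xi_def superpos_def add_divide_distrib)

text \<open>The two words of a measured branch are distinct, so squared moduli add. The factor 1/2
  comes from the Hadamard gate, and the sign depending on \<open>r\<close> drops out.\<close>

lemma outcome_prob_superpos:
  fixes k :: nat
  assumes "k > 0"
  shows "outcome_prob (Suc k) (superpos \<alpha> (replicate (Suc k) False) \<beta> (replicate (Suc k) True))
     (superpos \<gamma> [False, False] \<delta> [True, True]) r s =
     ((cmod \<alpha>)\<^sup>2 * (cmod (if s then \<delta> else \<gamma>))\<^sup>2 + (cmod \<beta>)\<^sup>2 * (cmod (if s then \<gamma> else \<delta>))\<^sup>2) / 2"
proof -
  have "replicate k False \<noteq> replicate k True" using assms by (cases k) auto
  then show ?thesis
    unfolding outcome_prob_def project_before_measurement
    by (subst norm_sq_superpos)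
      (auto simp: norm_mult norm_divide power_mult_distrib power_divide add_divide_distrib)
qed

text \<open>Qubit \<open>j - 1 = k\<close> lies in the block of equal qubits, so Z tells the two
  terms apart and removes the sign. \<open>N\<close> merges the Hadamard factor with the
  renormalisation; for an outcome of probability 0 it is 0, and both sides vanish through division
  by zero.\<close>

lemma swap_result_superpos:
  fixes k m p :: nat and \<alpha> \<beta> \<gamma> \<delta> :: complex and r s :: bool
  assumes k: "k > 0"
  defines "\<psi> \<equiv> superpos \<alpha> (replicate (Suc k) False) \<beta> (replicate (Suc k) True)"
    and "\<phi> \<equiv> superpos \<gamma> [False, False] \<delta> [True, True]"
  defines "N \<equiv> complex_of_real (sqrt 2) * complex_of_real (sqrt (outcome_prob (Suc k) \<psi> \<phi> r s))"
  shows "swap_result (Suc k) m p \<psi> \<phi> r s =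
     (if \<not> s then superpos (\<alpha> * \<gamma> / N) (replicate (Suc k) False) (\<beta> * \<delta> / N) (replicate (Suc k) True)
      else if p \<le> m then
        superpos (\<alpha> * \<delta> / N) (replicate (Suc k) False) (\<beta> * \<gamma> / N) (replicate (Suc k) True)
      else superpos (\<beta> * \<gamma> / N) (replicate (Suc k) False) (\<alpha> * \<delta> / N) (replicate (Suc k) True))"
proof -
  have "after_measurement (Suc k) \<psi> \<phi> r s =
     superpos (\<alpha> * (if s then \<delta> else \<gamma>) / N) (replicate k False @ [r, s, s])
       ((if r then -1 else 1) * \<beta> * (if s then \<gamma> else \<delta>) / N) (replicate k True @ [r, s, \<not> s])"
    unfolding after_measurement_def \<psi>_def \<phi>_def project_before_measurement N_def
    by (rule ext) (simp add: superpos_def add_divide_distrib)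
  moreover have "qubit (replicate k c @ w) k = c" for c w
    using k by (simp add: qubit_def nth_append)
  ultimately have Z: "(if r then gate1 pauli_Z (Suc k - 1) else id)
        (after_measurement (Suc k) \<psi> \<phi> r s) =
     superpos (\<alpha> * (if s then \<delta> else \<gamma>) / N) (replicate k False @ [r, s, s])
       (\<beta> * (if s then \<gamma> else \<delta>) / N) (replicate k True @ [r, s, \<not> s])"
    by (simp add: gate1_pauli_Z_superpos)
  have last: "flip_qubit (k + 3) (replicate k c @ [r, s, t]) = replicate k c @ [r, s, \<not> t]" for c t
    using flip_qubit_append[of "replicate k c @ [r, s]" t "[]"] by (simp add: numeral_3_eq_3)
  \<comment> \<open>For \<open>m < p\<close> flipping the first \<open>k\<close> qubits exchanges
    the all-0 and all-1 blocks, hence the opposite order of the coefficients.\<close>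
  have "corrected (Suc k) m p \<psi> \<phi> r s =
     (if \<not> s then superpos (\<alpha> * \<gamma> / N) (replicate k False @ [r, s, False])
                       (\<beta> * \<delta> / N) (replicate k True @ [r, s, True])
      else if p \<le> m then superpos (\<alpha> * \<delta> / N) (replicate k False @ [r, s, False])
                       (\<beta> * \<gamma> / N) (replicate k True @ [r, s, True])
      else superpos (\<beta> * \<gamma> / N) (replicate k False @ [r, s, False])
                       (\<alpha> * \<delta> / N) (replicate k True @ [r, s, True]))"
    unfolding corrected_def Z correct_X_def
    using last[of False True] last[of True False]
      fold_flip_qubit_replicate[of k False] fold_flip_qubit_replicate[of k True]
    by (cases s) (auto simp: gate1_pauli_X_superpos fold_pauli_X_superpos numeral_3_eq_3
        superpos_commute[of "\<beta> * \<gamma> / N"] simp del: upt_Suc)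
  then show ?thesis
    unfolding swap_result_def
    by (simp add: superpos_drop_measured[simplified] replicate_append_same flip: replicate_Suc)
qed

text \<open>
  The probability of each of the two measurement outcomes \<open>(r, s)\<close> with given \<open>s\<close>.  From \<open>\<xi>\<^sub>0\<close> the
  outcome \<open>s = True\<close> leads to \<open>\<xi>\<^sub>1\<close>, as does \<open>s = False\<close>.
\<close>

definition step_prob :: "complex \<Rightarrow> complex \<Rightarrow> nat \<Rightarrow> bool \<Rightarrow> real" where
  "step_prob a b m s =
     (if \<not> s then (n_fac a b (m + 1))\<^sup>2
      else if m = 0 then 1 else (cmod a)\<^sup>2 * (cmod b)\<^sup>2 * (n_fac a b (m - 1))\<^sup>2)
      / (2 * (n_fac a b m)\<^sup>2)"

section \<open>One swap of \<open>xi\<close> with a fresh pair\<close>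

text \<open>For \<open>s = True\<close> the numerator is |a|^(2m) |b|^2 + |b|^(2m) |a|^2. If
  \<open>m > 0\<close>, the factor |a|^2 |b|^2 can be extracted; if \<open>m = 0\<close>, the sum is
  1 by normalisation.\<close>

lemma outcome_prob_xi:
  assumes ab: "(cmod a)\<^sup>2 + (cmod b)\<^sup>2 = 1" and "2 \<le> j"
    and c: "cmod c = 1" and \<psi>: "\<psi> = (\<lambda>w. c * xi a b j m w)"
  shows "outcome_prob j \<psi> (superpos a [False, False] b [True, True]) r s = step_prob a b m s"
proof -
  obtain k where j: "j = Suc k" and k: "k > 0" using \<open>2 \<le> j\<close> by (cases j) auto
  note pos = n_fac_pos[OF ab, of m]
  have \<psi>': "\<psi> = superpos (c * (a ^ m / n_fac a b m)) (replicate (Suc k) False)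
                       (c * (b ^ m / n_fac a b m)) (replicate (Suc k) True)"
    unfolding \<psi> xi_eq_superpos j by (rule ext) (simp add: superpos_def algebra_simps)
  define N where "N = (n_fac a b m)\<^sup>2"
  have N: "N > 0" using pos by (simp add: N_def)
  have "outcome_prob j \<psi> (superpos a [False, False] b [True, True]) r s =
     ((cmod a ^ m)\<^sup>2 / N * (cmod (if s then b else a))\<^sup>2
       + (cmod b ^ m)\<^sup>2 / N * (cmod (if s then a else b))\<^sup>2) / 2"
    unfolding \<psi>' j outcome_prob_superpos[OF k] using pos c
    by (simp add: norm_mult norm_divide norm_power power_divide N_def)
  also have "\<dots> = ((cmod a ^ m)\<^sup>2 * (cmod (if s then b else a))\<^sup>2
       + (cmod b ^ m)\<^sup>2 * (cmod (if s then a else b))\<^sup>2) / (2 * N)"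
    using N by (simp add: field_simps)
  also have "(cmod a ^ m)\<^sup>2 * (cmod (if s then b else a))\<^sup>2
       + (cmod b ^ m)\<^sup>2 * (cmod (if s then a else b))\<^sup>2 =
      (if \<not> s then (n_fac a b (m + 1))\<^sup>2
      else if m = 0 then 1 else (cmod a)\<^sup>2 * (cmod b)\<^sup>2 * (n_fac a b (m - 1))\<^sup>2)"
    unfolding n_fac_squared
    using ab by (cases m) (auto simp: power_mult power_mult_distrib power2_eq_square
        algebra_simps)
  finally show ?thesis by (simp add: step_prob_def N_def)
qed

text \<open>For \<open>s = True\<close> and \<open>m > 0\<close> the coefficients share the factor
  \<open>a * b\<close>: its modulus is absorbed by the renormalisation, its phase is global. A
  nonzero probability excludes division by zero.\<close>

lemma swap_result_xi:
  assumes ab: "(cmod a)\<^sup>2 + (cmod b)\<^sup>2 = 1" and "2 \<le> j"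
    and c: "cmod c = 1" and \<psi>: "\<psi> = (\<lambda>w. c * xi a b j m w)"
    and nz: "step_prob a b m s \<noteq> 0"
  shows "same_up_to_phase (swap_result j m 1 \<psi> (superpos a [False, False] b [True, True]) r s)
     (xi a b j (if \<not> s then m + 1 else if 1 \<le> m then m - 1 else 1 - m))"
proof -
  obtain k where j: "j = Suc k" and k: "k > 0" using \<open>2 \<le> j\<close> by (cases j) auto
  note pos = n_fac_pos[OF ab]
  have \<psi>': "\<psi> = superpos (c * (a ^ m / n_fac a b m)) (replicate j False)
                       (c * (b ^ m / n_fac a b m)) (replicate j True)"
    unfolding \<psi> xi_eq_superpos by (rule ext) (simp add: superpos_def algebra_simps)
  \<comment> \<open>\<open>t\<^sup>2\<close> is the numerator in \<open>step_prob\<close>, so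
    \<open>t / n_fac a b m\<close> is the divisor \<open>N\<close> of
    \<open>swap_result_superpos\<close>.\<close>
  define t where "t = (if \<not> s then n_fac a b (m + 1)
      else if m = 0 then 1 else cmod a * cmod b * n_fac a b (m - 1))"
  have "t \<ge> 0" using pos[of "m - 1"] pos[of "m + 1"] by (auto simp: t_def)
  have sp: "step_prob a b m s = (t / (sqrt 2 * n_fac a b m))\<^sup>2"
    by (simp add: step_prob_def t_def power_mult_distrib power_divide)
  with nz have "t \<noteq> 0" by auto
  have "sqrt 2 * sqrt (step_prob a b m s) = t / n_fac a b m"
    unfolding sp using \<open>t \<ge> 0\<close> pos[of m] by simp
  then have N: "complex_of_real (sqrt 2) * complex_of_real (sqrt (step_prob a b m s))
      = complex_of_real t / complex_of_real (n_fac a b m)"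
    by (metis of_real_mult of_real_divide)
  have prob: "outcome_prob j \<psi> (superpos a [False, False] b [True, True]) r s
      = step_prob a b m s"
    using outcome_prob_xi[OF ab \<open>2 \<le> j\<close> c \<psi>] .
  have quot: "c * (y / n_fac a b m) * z / (complex_of_real t / n_fac a b m) = c * y * z / t"
    for y z :: complex
    using pos[of m] \<open>t \<noteq> 0\<close> by (simp add: field_simps)
  have res: "swap_result j m 1 \<psi> (superpos a [False, False] b [True, True]) r s =
     (if \<not> s then superpos (c * a ^ m * a / t) (replicate j False) (c * b ^ m * b / t) (replicate j True)
      else if 1 \<le> m then
        superpos (c * a ^ m * b / t) (replicate j False) (c * b ^ m * a / t) (replicate j True)
      else superpos (c * b ^ m * a / t) (replicate j False) (c * a ^ m * b / t) (replicate j True))"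
    using swap_result_superpos[OF k, folded j, of m 1 "c * (a ^ m / n_fac a b m)"
        "c * (b ^ m / n_fac a b m)" a b r s]
    by (simp only: \<psi>'[symmetric] prob N quot)
  \<comment> \<open>The global phase: \<open>c\<close>, times the phase of \<open>a * b\<close>
    where that factor is extracted.\<close>
  define d where "d = (if s \<and> m > 0 then c * a * b / (cmod a * cmod b) else c)"
  have "cmod d = 1"
  proof (cases "s \<and> m > 0")
    case True
    then have "a \<noteq> 0" "b \<noteq> 0" using \<open>t \<noteq> 0\<close> by (auto simp: t_def)
    then show ?thesis using True c by (simp add: d_def norm_mult norm_divide)
  qed (use c in \<open>auto simp: d_def\<close>)
  moreover have "swap_result j m 1 \<psi> (superpos a [False, False] b [True, True]) r s =
     (\<lambda>w. d * xi a b j (if \<not> s then m + 1 else if 1 \<le> m then m - 1 else 1 - m) w)"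
  proof -
    \<comment> \<open>For \<open>m = 0\<close> and \<open>s = True\<close> the divisor is
      \<open>t = 1\<close>, which has to agree with the normalisation of
      \<open>\<xi>\<^sub>1\<close>.\<close>
    have n1: "n_fac a b (Suc 0) = 1" using ab by (simp add: n_fac_def)
    have scale: "(\<lambda>w. d * superpos \<alpha> v \<beta> v' w) = superpos (d * \<alpha>) v (d * \<beta>) v'" for \<alpha> \<beta> v v'
      by (rule ext) (simp add: superpos_def algebra_simps)
    show ?thesis
    proof (cases "s \<and> m > 0")
      case True
      then obtain i where "m = Suc i" by (cases m) auto
      with True show ?thesis
        unfolding res xi_eq_superpos scale by (simp add: d_def t_def mult_ac)
    next
      case False
      then show ?thesis
        unfolding res xi_eq_superpos scale by (auto simp: d_def t_def n1 mult_ac)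
    qed
  qed
  ultimately show ?thesis unfolding same_up_to_phase_def by blast
qed

section \<open>The walk of the index and its weights\<close>

text \<open>Collected by index rather than by state, as different indices may carry the same
  state.\<close>

definition index_weight :: "nat \<Rightarrow> (real \<times> nat \<times> state) list \<Rightarrow> real" where
  "index_weight m L = (\<Sum>(q, k, \<psi>)\<leftarrow>L. if k = m then q else 0)"

lemma index_weight_concat:
  "index_weight m (concat (map f L)) = (\<Sum>y\<leftarrow>L. index_weight m (f y))"
  by (induction L) (simp_all add: index_weight_def)

text \<open>Outcomes of probability 0 are left out because their state results from a division by
  zero.\<close>

lemma swap_map_xi:
  assumes "(cmod a)\<^sup>2 + (cmod b)\<^sup>2 = 1" "2 \<le> j" "same_up_to_phase \<psi> (xi a b j k)"
    and "(q, m, \<psi>') \<in> set (swap_map j k 1 \<psi> (superpos a [False, False] b [True, True]))"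
    and "q \<noteq> 0"
  shows "same_up_to_phase \<psi>' (xi a b j m)"
proof -
  obtain c where c: "cmod c = 1" "\<psi> = (\<lambda>w. c * xi a b j k w)"
    using assms(3) unfolding same_up_to_phase_def by blast
  obtain r s where rs: "q = outcome_prob j \<psi> (superpos a [False, False] b [True, True]) r s"
    "m = (if \<not> s then k + 1 else if 1 \<le> k then k - 1 else 1 - k)"
    "\<psi>' = swap_result j k 1 \<psi> (superpos a [False, False] b [True, True]) r s"
    using assms(4) unfolding swap_map_def by auto
  have "step_prob a b k s \<noteq> 0"
    using \<open>q \<noteq> 0\<close> unfolding rs(1) outcome_prob_xi[OF assms(1,2) c] .
  then show ?thesis
    unfolding rs(2,3) by (rule swap_result_xi[OF assms(1,2) c])
qed

text \<open>Gives the parity of the walk. It does not depend on the states and so covers branches of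
  probability 0.\<close>

lemma swap_map_index:
  assumes "(q, m, \<psi>') \<in> set (swap_map j k 1 \<psi> \<phi>)"
  shows "m = k + 1 \<or> k = m + 1 \<or> k = 0 \<and> m = 1"
  using assms by (cases k) (auto simp: swap_map_def)

text \<open>The factor 2 counts the two equally likely values of \<open>r\<close>. For
  \<open>k = 0\<close> and \<open>m = 1\<close> both terms occur, one for each
  \<open>s\<close>.\<close>

lemma index_weight_swap_map:
  assumes "(cmod a)\<^sup>2 + (cmod b)\<^sup>2 = 1" "2 \<le> j" "same_up_to_phase \<psi> (xi a b j k)"
  shows "index_weight m (swap_map j k 1 \<psi> (superpos a [False, False] b [True, True])) =
     (if m = k + 1 then 2 * step_prob a b k False else 0) +
     (if k = m + 1 \<or> k = 0 \<and> m = 1 then 2 * step_prob a b k True else 0)"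
proof -
  obtain c where c: "cmod c = 1" "\<psi> = (\<lambda>w. c * xi a b j k w)"
    using assms(3) unfolding same_up_to_phase_def by blast
  show ?thesis
    unfolding index_weight_def swap_map_def
    by (cases k) (auto simp: outcome_prob_xi[OF assms(1,2) c])
qed

text \<open>\<open>n\<close> counts the downward moves: an upward move raises \<open>m\<close> along
  with \<open>x\<close>, a downward one lowers \<open>m\<close> and raises \<open>n\<close>. The
  parity is kept for all branches, since even those of probability 0 must be put into a
  group.\<close>

lemma swaps_xi:
  assumes ab: "(cmod a)\<^sup>2 + (cmod b)\<^sup>2 = 1" "2 \<le> j"
    and "(q, m, \<psi>) \<in> set (swaps j (superpos a [False, False] b [True, True]) (xi a b j 1) x)"
  shows "\<exists>n. 2 * n + m = x + 1" and "q \<noteq> 0 \<Longrightarrow> same_up_to_phase \<psi> (xi a b j m)"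
proof -
  have "(\<exists>n. 2 * n + m = x + 1) \<and> (q \<noteq> 0 \<longrightarrow> same_up_to_phase \<psi> (xi a b j m))"
    using assms(3)
  proof (induction x arbitrary: q m \<psi>)
    case 0
    then show ?case by (auto simp: same_up_to_phase_def intro!: exI[of _ 1])
  next
    case (Suc x)
    then obtain q1 k \<psi>1 q2 where
      1: "(q1, k, \<psi>1) \<in> set (swaps j (superpos a [False, False] b [True, True]) (xi a b j 1) x)" and
      2: "(q2, m, \<psi>) \<in> set (swap_map j k 1 \<psi>1 (superpos a [False, False] b [True, True]))" and
      q: "q = q1 * q2"
      by auto
    from Suc.IH[OF 1] obtain n where "2 * n + k = x + 1" by auto
    with swap_map_index[OF 2] have "2 * n + m = Suc x + 1 \<or> 2 * (n + 1) + m = Suc x + 1" by auto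
    moreover have "same_up_to_phase \<psi> (xi a b j m)" if "q \<noteq> 0"
      using swap_map_xi[OF ab _ 2] Suc.IH[OF 1] that q by auto
    ultimately show ?case by blast
  qed
  then show "\<exists>n. 2 * n + m = x + 1" and "q \<noteq> 0 \<Longrightarrow> same_up_to_phase \<psi> (xi a b j m)" by auto
qed

text \<open>The forward equation of the walk. The last term is the second route from 0 to 1, by
  \<open>s = True\<close>; the first is guarded because \<open>m - 1\<close> is truncated at
  0.\<close>

lemma index_weight_swaps_Suc:
  fixes a b :: complex and j :: nat
  assumes ab: "(cmod a)\<^sup>2 + (cmod b)\<^sup>2 = 1" "2 \<le> j"
  defines "L \<equiv> swaps j (superpos a [False, False] b [True, True]) (xi a b j 1)"
  shows "index_weight m (L (Suc x)) =
     (if m = 0 then 0 else 2 * step_prob a b (m - 1) False * index_weight (m - 1) (L x))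
     + 2 * step_prob a b (m + 1) True * index_weight (m + 1) (L x)
     + (if m = 1 then 2 * step_prob a b 0 True * index_weight 0 (L x) else 0)"
proof -
  let ?\<eta> = "superpos a [False, False] b [True, True]"
  let ?w = "\<lambda>k::nat. (if m = k + 1 then 2 * step_prob a b k False else 0) +
     (if k = m + 1 \<or> k = 0 \<and> m = 1 then 2 * step_prob a b k True else 0)"
  have scaled: "index_weight m (map (\<lambda>(q', m', \<psi>'). (q * q', m', \<psi>')) M) = q * index_weight m M"
    for q M by (induction M) (auto simp: index_weight_def algebra_simps)
  have collect: "(\<Sum>(q, k, \<psi>)\<leftarrow>M. q * ?w k) =
     (if m = 0 then 0 else 2 * step_prob a b (m - 1) False * index_weight (m - 1) M)
     + 2 * step_prob a b (m + 1) True * index_weight (m + 1) M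
     + (if m = 1 then 2 * step_prob a b 0 True * index_weight 0 M else 0)" for M
    by (induction M) (auto simp: index_weight_def algebra_simps)
  \<comment> \<open>If \<open>q = 0\<close>, the state need not be an \<open>xi\<close>, but then
    both sides vanish.\<close>
  have branch: "q * index_weight m (swap_map j k 1 \<psi> ?\<eta>) = q * ?w k" if "(q, k, \<psi>) \<in> set (L x)"
    for q k \<psi>
  proof (cases "q = 0")
    case False
    with index_weight_swap_map[OF ab swaps_xi(2)[OF ab that[unfolded L_def]]] show ?thesis by simp
  qed simp
  have "index_weight m (L (Suc x)) =
      (\<Sum>(q, k, \<psi>)\<leftarrow>L x. q * index_weight m (swap_map j k 1 \<psi> ?\<eta>))"
    unfolding L_def swaps.simps index_weight_concat
    by (rule arg_cong[of _ _ sum_list], rule map_cong[OF refl], clarify) (simp only: prod.case scaled)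
  also have "\<dots> = (\<Sum>(q, k, \<psi>)\<leftarrow>L x. q * ?w k)"
    by (rule arg_cong[of _ _ sum_list], rule map_cong[OF refl]) (use branch in auto)
  also have "\<dots> =
     (if m = 0 then 0 else 2 * step_prob a b (m - 1) False * index_weight (m - 1) (L x))
     + 2 * step_prob a b (m + 1) True * index_weight (m + 1) (L x)
     + (if m = 1 then 2 * step_prob a b 0 True * index_weight 0 (L x) else 0)"
    by (rule collect)
  finally show ?thesis .
qed

text \<open>The induction hypothesis is used at \<open>m - 1\<close> with the same \<open>n\<close>
  and at \<open>m + 1\<close> with \<open>n - 1\<close>.\<close>

lemma index_weight_swaps:
  fixes a b :: complex and j :: nat
  assumes ab: "(cmod a)\<^sup>2 + (cmod b)\<^sup>2 = 1" "2 \<le> j"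
    and "2 * n + m = x + 1"
  defines "L \<equiv> swaps j (superpos a [False, False] b [True, True]) (xi a b j 1)"
  shows "index_weight m (L x) =
     real ((x + 1) choose n) * ((cmod a)\<^sup>2 * (cmod b)\<^sup>2) ^ n * (n_fac a b m)\<^sup>2 / (if m = 0 then 2 else 1)"
  using assms(3)
proof (induction x arbitrary: n m)
  case 0
  then have "n = 0" "m = 1" by presburger+
  then show ?case using ab by (simp add: L_def index_weight_def n_fac_squared)
next
  case (Suc x)
  let ?AB = "(cmod a)\<^sup>2 * (cmod b)\<^sup>2"
  note pos = n_fac_pos[OF ab(1)]
  have up: "2 * step_prob a b k False = (n_fac a b (k + 1))\<^sup>2 / (n_fac a b k)\<^sup>2" for k
    by (simp add: step_prob_def)
  have down: "2 * step_prob a b (k + 1) True = ?AB * (n_fac a b k)\<^sup>2 / (n_fac a b (k + 1))\<^sup>2" for k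
    by (simp add: step_prob_def)
  have n0: "(n_fac a b 0)\<^sup>2 = 2" and n1: "(n_fac a b 1)\<^sup>2 = 1"
    using ab by (simp_all add: n_fac_squared)
  have bounce: "2 * step_prob a b 0 True = 1 / 2" by (simp add: step_prob_def n0)
  \<comment> \<open>The factor 2 at \<open>k = 0\<close> cancels the halving in the hypothesis; the
    second route from 0 to 1 will supply it.\<close>
  have from_below: "2 * step_prob a b k False * index_weight k (L x) * (if k = 0 then 2 else 1) =
      real ((x + 1) choose n) * ?AB ^ n * (n_fac a b (k + 1))\<^sup>2" if "m = k + 1" for k
    using Suc.IH[of n k] Suc.prems that pos[of k] unfolding up by (simp add: field_simps)
  have from_above: "2 * step_prob a b (m + 1) True * index_weight (m + 1) (L x) =
      (if n = 0 then 0 else real ((x + 1) choose (n - 1)) * ?AB ^ n * (n_fac a b m)\<^sup>2)"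
  proof (cases n)
    case 0
    \<comment> \<open>Here \<open>m = x + 2\<close>, while after \<open>x\<close> swaps no index
      exceeds \<open>x + 1\<close>.\<close>
    have "index_weight (m + 1) (L x) = (\<Sum>y\<leftarrow>L x. 0)"
      unfolding index_weight_def
    proof (rule arg_cong[of _ _ sum_list], rule map_cong[OF refl], clarify)
      fix q k \<psi> assume "(q, k, \<psi>) \<in> set (L x)"
      from swaps_xi(1)[OF ab this[unfolded L_def]] have "k \<le> x + 1" by auto
      then show "(if k = m + 1 then q else 0) = 0" using Suc.prems 0 by simp
    qed
    then show ?thesis using 0 by simp
  next
    case (Suc n')
    then show ?thesis
      using Suc.IH[of n' "m + 1"] Suc.prems pos[of "m + 1"] unfolding down by simp
  qed
  have pascal: "real ((x + 2) choose n) = real ((x + 1) choose n)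
      + (if n = 0 then 0 else real ((x + 1) choose (n - 1)))"
    by (cases n) simp_all
  \<comment> \<open>0 is reached only from 1, and 1 is reached from 0 by two routes; from 2 on the
    walk is regular.\<close>
  consider "m = 0" | "m = 1" | k where "m = Suc (Suc k)" by (metis One_nat_def not0_implies_Suc)
  then show ?case
  proof cases
    case 1
    then have "n > 0" "x + 2 = 2 * n" using Suc.prems by auto
    then have "n \<le> x + 1" "x + 1 - n = n - 1" by auto
    \<comment> \<open>The two summands of Pascal's rule coincide, which cancels the division by
      2.\<close>
    then have "(x + 1) choose n = (x + 1) choose (n - 1)"
      using binomial_symmetric[of n "x + 1"] by simp
    then show ?thesis
      using index_weight_swaps_Suc[OF ab, of m x, folded L_def] from_above pascal 1 \<open>n > 0\<close> n0
      by simp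
  next
    case 2
    \<comment> \<open>Both routes from 0 to 1 have probability 1/2, so together they count one of
      them twice.\<close>
    have "index_weight m (L (Suc x)) =
       2 * step_prob a b 0 False * index_weight 0 (L x) * 2
       + 2 * step_prob a b (m + 1) True * index_weight (m + 1) (L x)"
      using index_weight_swaps_Suc[OF ab, of m x, folded L_def] 2 bounce up[of 0] n0 n1 by simp
    then show ?thesis
      using from_above from_below[of 0] pascal 2 by (simp add: algebra_simps)
  next
    case 3
    then show ?thesis
      using index_weight_swaps_Suc[OF ab, of m x, folded L_def] from_above from_below[of "Suc k"] pascal
      by (simp add: algebra_simps)
  qed
qed

section \<open>Grouping the branches by their number of downward moves\<close>

theorem mainTheorem5:
  fixes a b :: complex and j x :: nat and \<eta> \<xi> :: state
  assumes "(cmod a)\<^sup>2 + (cmod b)\<^sup>2 = 1"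
    and "2 \<le> j"
    and "\<eta> = (\<lambda>w. a * ket [False, False] w + b * ket [True, True] w)"
    and "\<xi> = (\<lambda>w. a * ket (replicate j False) w + b * ket (replicate j True) w)"
  shows "listed_as (swap_output j \<eta> \<xi> x) {n. 2 * n \<le> x + 1}
           (\<lambda>n. xi a b j (x + 1 - 2 * n))
           (\<lambda>n. real ((x + 1) choose n) * cmod a ^ (2 * n) * cmod b ^ (2 * n)
                  * (n_fac a b (x + 1 - 2 * n))\<^sup>2
                  / (if 2 * n = x + 1 then 2 else 1))"
proof -
  have \<eta>: "\<eta> = superpos a [False, False] b [True, True]"
    unfolding assms(3) superpos_def ..
  have "n_fac a b 1 = 1" using assms(1) by (simp add: n_fac_def)
  then have \<xi>: "\<xi> = xi a b j 1"
    unfolding assms(4) xi_eq_superpos superpos_def by simp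
  define L where "L = swaps j \<eta> \<xi> x"
  \<comment> \<open>Solves \<open>2 * n + m = x + 1\<close> for \<open>n\<close>, with
    \<open>m\<close> the index of branch \<open>i\<close>.\<close>
  define g where "g i = (x + 1 - fst (snd (L ! i))) div 2" for i
  have out: "swap_output j \<eta> \<xi> x = map (\<lambda>(q, m, \<psi>). (q, \<psi>)) L"
    by (simp add: swap_output_def L_def)
  have entry: "\<exists>q m \<psi>. L ! i = (q, m, \<psi>) \<and> 2 * g i + m = x + 1 \<and>
      (q \<noteq> 0 \<longrightarrow> same_up_to_phase \<psi> (xi a b j m))" if "i < length L" for i
  proof -
    obtain q m \<psi> where i: "L ! i = (q, m, \<psi>)" by (metis prod_cases3)
    with that have mem: "(q, m, \<psi>) \<in> set L" by (metis nth_mem)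
    note inv = swaps_xi[OF assms(1,2) mem[unfolded L_def \<eta> \<xi>]]
    from inv(1) obtain n where "2 * n + m = x + 1" by auto
    then have "2 * g i + m = x + 1" unfolding g_def i by simp presburger
    with i inv(2) show ?thesis by auto
  qed
  have "g i \<in> {n. 2 * n \<le> x + 1} \<and> (fst (map (\<lambda>(q, m, \<psi>). (q, \<psi>)) L ! i) \<noteq> 0 \<longrightarrow>
      same_up_to_phase (snd (map (\<lambda>(q, m, \<psi>). (q, \<psi>)) L ! i)) (xi a b j (x + 1 - 2 * g i)))"
    if i: "i < length L" for i
  proof -
    from entry[OF i] obtain q m \<psi> where "L ! i = (q, m, \<psi>)" and m: "2 * g i + m = x + 1"
      and "q \<noteq> 0 \<longrightarrow> same_up_to_phase \<psi> (xi a b j m)" by blast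
    moreover from m have "x + 1 - 2 * g i = m" "2 * g i \<le> x + 1" by auto
    ultimately show ?thesis using i by auto
  qed
  moreover have "(\<Sum>i | i < length L \<and> g i = n. fst (map (\<lambda>(q, m, \<psi>). (q, \<psi>)) L ! i)) =
      real ((x + 1) choose n) * cmod a ^ (2 * n) * cmod b ^ (2 * n)
        * (n_fac a b (x + 1 - 2 * n))\<^sup>2 / (if 2 * n = x + 1 then 2 else 1)"
    if n: "2 * n \<le> x + 1" for n
  proof -
    let ?m = "x + 1 - 2 * n"
    have "(\<Sum>i | i < length L \<and> g i = n. fst (map (\<lambda>(q, m, \<psi>). (q, \<psi>)) L ! i)) =
        (\<Sum>i<length L. if g i = n then fst (map (\<lambda>(q, m, \<psi>). (q, \<psi>)) L ! i) else 0)"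
      by (simp add: sum.If_cases Int_def lessThan_def)
    also have "\<dots> = (\<Sum>i<length L. (\<lambda>(q, k, \<psi>). if k = ?m then q else 0) (L ! i))"
    proof (rule sum.cong[OF refl])
      fix i assume "i \<in> {..<length L}"
      then have i: "i < length L" by simp
      from entry[OF i] obtain q m \<psi> where Li: "L ! i = (q, m, \<psi>)" and "2 * g i + m = x + 1"
        by blast
      \<comment> \<open>Group number and index determine each other, so a group sum is an index
        weight.\<close>
      then have "g i = n \<longleftrightarrow> m = ?m" using n by auto
      then show "(if g i = n then fst (map (\<lambda>(q, m, \<psi>). (q, \<psi>)) L ! i) else 0) =
          (\<lambda>(q, k, \<psi>). if k = ?m then q else 0) (L ! i)"
        using i Li by simp
    qed
    also have "\<dots> = index_weight ?m L"
      by (simp add: index_weight_def sum_list_sum_nth atLeast0LessThan)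
    also have "\<dots> = real ((x + 1) choose n) * ((cmod a)\<^sup>2 * (cmod b)\<^sup>2) ^ n
        * (n_fac a b ?m)\<^sup>2 / (if ?m = 0 then 2 else 1)"
      unfolding L_def \<eta> \<xi> by (rule index_weight_swaps[OF assms(1,2)]) (use n in simp)
    \<comment> \<open>The bound on \<open>n\<close> keeps the truncated subtraction exact.\<close>
    also have "(?m = 0) = (2 * n = x + 1)" using n by auto
    finally show ?thesis by (simp only: power_mult power_mult_distrib mult.assoc)
  qed
  ultimately show ?thesis
    unfolding listed_as_def out by (intro exI[of _ g]) simp
qed

end
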